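(* The binary operation $(x,y)\mapsto x\bmod y$ on $\mathbb{N}$ does not belong to $\langle x+y,\ 2^x\rangle$.
   Context: $\mathbb{N}$ is the set of non-negative integers. An ($r$-ary, $r\ge 1$) operation on $\mathbb{N}$ is a function $\mathbb{N}^r\to\mathbb{N}$. Conventions: $\lfloor x/0\rfloor:=0$, and $x\bmod y:=\max(x-y\lfloor x/y\rfloor,0)$, so that $x\bmod 0=x$. A set $S$ of operations on $\mathbb{N}$ is closed under substitution if, whenever $f\in S$ is $r$-ary and $g_1,\dots,g_r\in S$ are $n$-ary, the operation $\vec x\mapsto f(g_1(\vec x),\dots,g_r(\vec x))$ is in $S$. For a set $\mathcal{B}$ of operations on $\mathbb{N}$, $\langle\mathcal{B}\rangle$ denotes the closure under substitution of $\mathcal{B}\cup C\cup P$, where $C$ is the set of all constant operations on $\mathbb{N}$ (of every arity) and $P$ is the set of all projections $(x_1,\dots,x_n)\mapsto x_i$. Here $x+y$ denotes the binary operation $(x,y)\mapsto x+y$ and $2^x$ the unary operation $x\mapsto 2^x$. *)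

theory Defs
  imports Complex_Main "HOL-Library.FuncSet"
begin

text \<open>
  An \<open>r\<close>-ary operation on the natural numbers is represented by the pair of its arity \<open>r\<close> and a
  function on lists that is extensional on the lists of length \<open>r\<close>. In this way equality
  of pairs is exactly equality of operations (same arity, same values on all \<open>r\<close>-tuples).
\<close>

type_synonym operation = "nat \<times> (nat list \<Rightarrow> nat)"

definition tuples :: "nat \<Rightarrow> nat list set" where
  "tuples r = {xs. length xs = r}"

definition operations :: "operation set" where
  "operations = (SIGMA r:{1..}. tuples r \<rightarrow>\<^sub>E UNIV)"

definition opn :: "nat \<Rightarrow> (nat list \<Rightarrow> nat) \<Rightarrow> operation" where
  "opn r f = (r, restrict f (tuples r))"

definition unary_op :: "(nat \<Rightarrow> nat) \<Rightarrow> operation" where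
  "unary_op f = opn 1 (\<lambda>xs. f (xs ! 0))"

definition binary_op :: "(nat \<Rightarrow> nat \<Rightarrow> nat) \<Rightarrow> operation" where
  "binary_op f = opn 2 (\<lambda>xs. f (xs ! 0) (xs ! 1))"

definition constant_ops :: "operation set" where
  "constant_ops = {opn r (\<lambda>_. c) | r c. r \<ge> 1}"

definition projection_ops :: "operation set" where
  "projection_ops = {opn n (\<lambda>xs. xs ! i) | n i. i < n}"

definition closed_under_substitution :: "operation set \<Rightarrow> bool" where
  "closed_under_substitution S \<longleftrightarrow>
     (\<forall>r f n gs. (r, f) \<in> S \<and> length gs = r \<and> (\<forall>g\<in>set gs. (n, g) \<in> S) \<longrightarrow>
        opn n (\<lambda>xs. f (map (\<lambda>g. g xs) gs)) \<in> S)"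

definition substitution_closure :: "operation set \<Rightarrow> operation set" where
  "substitution_closure B =
     closed_under_substitution hull (B \<union> constant_ops \<union> projection_ops)"

lemma opn_in_operations: "r \<ge> 1 \<Longrightarrow> opn r f \<in> operations"
  by (auto simp: opn_def operations_def)

lemma opn_eq_iff: "opn r f = opn s g \<longleftrightarrow> r = s \<and> (\<forall>xs. length xs = r \<longrightarrow> f xs = g xs)"
  by (auto simp: opn_def tuples_def restrict_def fun_eq_iff)

lemma binary_op_eq_iff: "binary_op f = binary_op g \<longleftrightarrow> f = g"
proof
  assume "binary_op f = binary_op g"
  then have *: "\<forall>xs. length xs = 2 \<longrightarrow> f (xs ! 0) (xs ! 1) = g (xs ! 0) (xs ! 1)"
    by (simp add: binary_op_def opn_eq_iff)
  show "f = g"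
  proof (intro ext)
    fix x y show "f x y = g x y" using *[rule_format, of "[x, y]"] by simp
  qed
qed simp

lemma closed_operations: "closed_under_substitution operations"
  unfolding closed_under_substitution_def
proof (intro allI impI)
  fix r f n gs
  assume *: "(r, f) \<in> operations \<and> length gs = r \<and> (\<forall>g\<in>set gs. (n, g) \<in> operations)"
  then have "r \<ge> 1" by (simp add: operations_def)
  with * have "gs ! 0 \<in> set gs" by simp
  with * have "(n, gs ! 0) \<in> operations" by blast
  then have "n \<ge> 1" by (simp add: operations_def)
  then show "opn n (\<lambda>xs. f (map (\<lambda>g. g xs) gs)) \<in> operations"
    by (rule opn_in_operations)
qed

lemma closed_substitution_closure: "closed_under_substitution (substitution_closure B)"
  unfolding substitution_closure_def
  by (rule hull_in) (unfold closed_under_substitution_def, blast)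

lemma substitution_closure_subset_operations:
  assumes "B \<subseteq> operations"
  shows "substitution_closure B \<subseteq> operations"
  unfolding substitution_closure_def
proof (rule hull_minimal)
  show "B \<union> constant_ops \<union> projection_ops \<subseteq> operations"
    using assms by (auto simp: constant_ops_def projection_ops_def intro!: opn_in_operations)
qed (rule closed_operations)

text \<open>
  The conventions \<open>\<lfloor>x / 0\<rfloor> = 0\<close> and \<open>x mod y = max (x - y \<lfloor>x / y\<rfloor>) 0\<close> are
  those of the library \<open>mod\<close> on \<open>nat\<close>; in particular \<open>x mod 0 = x\<close>.
\<close>

lemma nat_mod_conv_floor:
  fixes x y :: nat
  shows "int (x mod y) = max (int x - int y * \<lfloor>real x / real y\<rfloor>) 0"
proof -
  have "int x - int y * \<lfloor>real x / real y\<rfloor> = int (x mod y)"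
    by (simp add: floor_divide_of_nat_eq zdiv_int zmod_int minus_mult_div_eq_mod)
  then show ?thesis by simp
qed

end

theory Submission
  imports Defs
begin

text \<open>The closure is the least substitution-closed set containing the generators, the
  constants and the projections, so any substitution-closed property of all of these passes to every
  member. Monotonicity is such an invariant (\<open>closed_monotone_ops\<close>,
  \<open>substitution_closure_subset_monotone_ops\<close>), and \<open>mod\<close> violates it in
  its first argument.\<close>

text \<open>
  Addition, \<open>2 ^ x\<close>, constants and projections are monotone in every argument, and substitution
  preserves this; but \<open>1 mod 2 > 2 mod 2\<close>.
\<close>

definition monotone_ops :: "operation set" where
  "monotone_ops = {(r, f). \<forall>xs ys. length xs = r \<longrightarrow> list_all2 (\<le>) xs ys \<longrightarrow> f xs \<le> f ys}"

lemma opn_in_monotone_ops_iff: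
  "opn r f \<in> monotone_ops \<longleftrightarrow>
     (\<forall>xs ys. length xs = r \<longrightarrow> list_all2 (\<le>) xs ys \<longrightarrow> f xs \<le> f ys)"
proof -
  have "restrict f (tuples r) xs \<le> restrict f (tuples r) ys \<longleftrightarrow> f xs \<le> f ys"
    if "length xs = r" "list_all2 (\<le>) xs ys" for xs ys
    using that by (auto simp: tuples_def dest: list_all2_lengthD)
  then show ?thesis by (simp add: monotone_ops_def opn_def)
qed

lemmas monotone_opsI = opn_in_monotone_ops_iff[THEN iffD2, rule_format]

lemma closed_monotone_ops: "closed_under_substitution monotone_ops"
  unfolding closed_under_substitution_def
proof (intro allI impI)
  fix r f n gs
  assume *: "(r, f) \<in> monotone_ops \<and> length gs = r \<and> (\<forall>g\<in>set gs. (n, g) \<in> monotone_ops)"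
  show "opn n (\<lambda>xs. f (map (\<lambda>g. g xs) gs)) \<in> monotone_ops"
  proof (rule monotone_opsI)
    fix xs ys :: "nat list"
    assume "length xs = n" "list_all2 (\<le>) xs ys"
    \<comment> \<open>Monotone inner operations give entrywise comparable argument lists of length
      \<open>r\<close>, to which monotonicity of \<open>f\<close> applies.\<close>
    with * have "list_all2 (\<le>) (map (\<lambda>g. g xs) gs) (map (\<lambda>g. g ys) gs)"
      by (auto simp: monotone_ops_def list_all2_conv_all_nth)
    with * show "f (map (\<lambda>g. g xs) gs) \<le> f (map (\<lambda>g. g ys) gs)"
      by (simp add: monotone_ops_def)
  qed
qed

lemma substitution_closure_subset_monotone_ops:
  assumes "B \<subseteq> monotone_ops"
  shows "substitution_closure B \<subseteq> monotone_ops"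
  unfolding substitution_closure_def
proof (rule hull_minimal)
  show "B \<union> constant_ops \<union> projection_ops \<subseteq> monotone_ops"
    using assms
    by (auto simp: constant_ops_def projection_ops_def list_all2_conv_all_nth intro!: monotone_opsI)
qed (rule closed_monotone_ops)

theorem theorem8:
  shows "binary_op (\<lambda>x y. x mod y)
           \<notin> substitution_closure {binary_op (\<lambda>x y. x + y), unary_op (\<lambda>x. 2 ^ x)}"
proof
  let ?B = "{binary_op (\<lambda>x y. x + y), unary_op (\<lambda>x. 2 ^ x)}"
  assume "binary_op (\<lambda>x y. x mod y) \<in> substitution_closure ?B"
  moreover have "?B \<subseteq> monotone_ops"
    by (auto simp: binary_op_def unary_op_def list_all2_conv_all_nth
        intro!: monotone_opsI add_mono power_increasing)
  ultimately have "binary_op (\<lambda>x y. x mod y) \<in> monotone_ops"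
    using substitution_closure_subset_monotone_ops by blast
  then have "\<forall>xs ys :: nat list. length xs = 2 \<longrightarrow> list_all2 (\<le>) xs ys \<longrightarrow>
      xs ! 0 mod xs ! 1 \<le> ys ! 0 mod ys ! 1"
    unfolding binary_op_def opn_in_monotone_ops_iff .
  \<comment> \<open>With the modulus fixed at 2, the remainder drops from 1 to 0 as the dividend
    reaches the modulus.\<close>
  from this[rule_format, of "[1, 2]" "[2, 2]"] have "(1 :: nat) mod 2 \<le> 2 mod 2"
    by simp
  then show False by simp
qed

end
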